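(* Let $G$ be an uncountable abelian Polish group. Then there exists a subset of $G$ that is naively Haar null but not Haar null.
   Context: A Polish group is a topological group whose topology is separable and completely metrizable. Borel measures are identified with their completions; so for a Borel probability measure $\mu$ on $G$ and an arbitrary set $A \subset G$, $\mu(A)=0$ means that $A$ is contained in a Borel set of $\mu$-measure zero. A subset of $G$ is universally measurable if it is measurable with respect to (the completion of) every Borel probability measure on $G$. A set $X \subset G$ is Haar null if there exist a universally measurable set $U \supset X$ and a Borel probability measure $\mu$ on $G$ such that $\mu(gUh)=0$ for every $g,h \in G$. A set $X \subset G$ is naively Haar null if there exists a Borel probability measure $\mu$ on $G$ such that $\mu(gXh)=0$ for every $g,h \in G$. *)

theory Defs
  imports "HOL-Probability.Probability"
begin

text \<open>
  Groups are written additively, as the type class hierarchy requires, but addition in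
  \<open>topological_group_add\<close> is not assumed to be commutative; the two-sided translate
  \<open>gXh\<close> becomes \<open>(\<lambda>x. g + x + h) ` X\<close>.
\<close>

definition borel_prob :: "'a::topological_space measure \<Rightarrow> bool" where
  "borel_prob \<mu> \<longleftrightarrow> prob_space \<mu> \<and> sets \<mu> = sets borel"

definition universally_measurable :: "'a::topological_space set \<Rightarrow> bool" where
  "universally_measurable U \<longleftrightarrow> (\<forall>\<mu>. borel_prob \<mu> \<longrightarrow> U \<in> sets (completion \<mu>))"

text \<open>
  Borel measures are identified with their completions, so \<open>\<mu>(A) = 0\<close> for an arbitrary set
  \<open>A\<close> is rendered as \<open>A \<in> null_sets (completion \<mu>)\<close>. This says that \<open>A\<close> is contained in a Borel
  set of \<open>\<mu>\<close>-measure zero (\<open>null_sets_completion_iff2\<close>); plain \<open>emeasure \<mu> A = 0\<close> would not do,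
  since it also holds for every non-measurable \<open>A\<close>.
\<close>

definition haar_null :: "'a::topological_group_add set \<Rightarrow> bool" where
  "haar_null X \<longleftrightarrow>
     (\<exists>U \<mu>. universally_measurable U \<and> X \<subseteq> U \<and> borel_prob \<mu> \<and>
        (\<forall>g h. (\<lambda>x. g + x + h) ` U \<in> null_sets (completion \<mu>)))"

definition naively_haar_null :: "'a::topological_group_add set \<Rightarrow> bool" where
  "naively_haar_null X \<longleftrightarrow>
     (\<exists>\<mu>. borel_prob \<mu> \<and> (\<forall>g h. (\<lambda>x. g + x + h) ` X \<in> null_sets (completion \<mu>)))"

end

theory Submission
  imports Defs
begin

text \<open>
  Only two very thin compact sets are used. There are Cantor sets \<open>P\<close> and \<open>Q\<close> in the group with
  \<open>(Q - Q) \<inter> ((P - P) - (P - P)) = {0}\<close>: both consist of subsums of one rapidly vanishing sequence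
  \<open>c\<close>, those over sets of odd indices and those over sets of even indices. Rapid decay replaces
  linear independence, which is unavailable in a group with torsion: a convergent sum
  \<open>\<Sum> e\<^sub>n c\<^sub>n\<close> with \<open>\<bar>e\<^sub>n\<bar> \<le> 2\<close> cannot vanish if some coefficient is \<open>\<plusminus>1\<close> (\<open>walk_lim_nonzero\<close>),
  because \<open>c\<^sub>n\<close> avoids the finitely many earlier partial sums and the tail is too small to
  compensate. Both sets carry atomless Borel probability measures, \<open>\<mu>\<close> on \<open>P\<close> and \<open>\<rho>\<close> on \<open>Q\<close>
  (\<open>atomless_prob_on_cantor_image\<close>).

  The set \<open>X\<close> is built by transfinite recursion so that no two of its points differ by an element of
  \<open>P - P\<close>. Then every translate of \<open>X\<close> meets \<open>P\<close> in at most one point and is \<open>\<mu>\<close>-null, which makes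
  \<open>X\<close> naively Haar null. At the same time \<open>X\<close> meets every closed set \<open>B\<close> that has continuum many
  points in some translate \<open>g + Q\<close>. This is possible because an earlier point \<open>y\<close> forbids only the
  points of \<open>y + (P - P)\<close>, and by the choice of \<open>P\<close> and \<open>Q\<close> this set meets \<open>g + Q\<close> in at most one
  point. As there are at most continuum many closed sets, at each stage fewer than continuum many
  points of \<open>g + Q\<close> are forbidden (\<open>transversal_selection\<close>).

  Finally suppose that a universally measurable \<open>U \<supseteq> X\<close> had only \<open>\<nu>\<close>-null translates. By Fubini
  \<open>U\<close> is null for the convolution of \<open>\<nu>\<close> and \<open>\<rho>\<close>, and therefore some translate of \<open>\<rho>\<close> gives measure
  \<open>0\<close> to a Borel set containing \<open>U\<close> (\<open>translate_avoids_almost_surely\<close>). Inner regularity yields an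
  uncountable compact subset of a translate of \<open>Q\<close> that misses \<open>U\<close>; it has cardinality continuum,
  so it contains a point of \<open>X\<close>, a contradiction. Going through the convolution handles all
  witnesses \<open>\<nu>\<close> at once by closed sets, although there may be more than continuum many universally
  measurable sets.
\<close>

section \<open>Transversals and the cardinality of closed sets\<close>

text \<open>
  Transfinite recursion along a well-order of \<open>I\<close> of minimal type: at stage \<open>i\<close> each of the
  previously chosen points excludes at most one point of \<open>C i\<close>, and there are fewer than \<open>\<bar>I\<bar>\<close>, hence
  fewer than \<open>\<bar>C i\<bar>\<close>, of them.
\<close>
lemma transversal_selection:
  fixes C :: "'i \<Rightarrow> 'a set"
  assumes big: "\<And>i. i \<in> I \<Longrightarrow> I \<lesssim> C i"
    and thin: "\<And>i y x x'. \<lbrakk>i \<in> I; x \<in> C i; x' \<in> C i; R x y; R x' y\<rbrakk> \<Longrightarrow> x = x'"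
    and sym: "\<And>x y. R x y \<Longrightarrow> R y x"
  obtains f where "\<And>i. i \<in> I \<Longrightarrow> f i \<in> C i"
    and "\<And>i j. \<lbrakk>i \<in> I; j \<in> I; i \<noteq> j\<rbrakk> \<Longrightarrow> \<not> R (f i) (f j)"
proof -
  let ?r = "card_of I"
  define P where "P f i x \<longleftrightarrow> (i \<in> I \<longrightarrow> x \<in> C i \<and> (\<forall>j \<in> underS ?r i. \<not> R x (f j)))"
    for f i and x :: 'a
  have wo: "well_order_on I ?r"
    using card_of_well_order_on by blast
  have "\<exists>f. \<forall>i. P f i (f i)"
  proof (rule dependent_wf_choice[of "?r - Id"])
    show "wf (?r - Id)"
      using wo by (simp add: well_order_on_def)
  next
    show "P f i x = P g i x" if "\<And>j. (j, i) \<in> ?r - Id \<Longrightarrow> f j = g j" for f g i x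
      using that by (auto simp: P_def underS_def)
  next
    fix i f
    show "\<exists>x. P f i x"
    proof (cases "i \<in> I")
      case True
      let ?S = "underS ?r i"
      \<comment> \<open>\<open>?Z\<close> contains every excluded point; junk values of \<open>SOME\<close> only enlarge it.\<close>
      let ?Z = "(\<lambda>j. SOME x. x \<in> C i \<and> R x (f j)) ` ?S"
      have "ordLess2 (card_of ?S) ?r"
        using True by (intro card_of_underS[OF card_of_Card_order]) (simp add: Field_card_of)
      then have "ordLess2 (card_of ?Z) ?r"
        using card_of_image ordLeq_ordLess_trans by blast
      moreover have "ordLeq3 ?r (card_of (C i))"
        using big[OF True] by (simp add: lepoll_def card_of_ordLeq)
      ultimately have "ordLess2 (card_of ?Z) (card_of (C i))"
        using ordLess_ordLeq_trans by blast
      then have "\<not> C i \<subseteq> ?Z"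
        by (meson card_of_mono1 not_ordLess_ordLeq)
      then obtain x where x: "x \<in> C i" "x \<notin> ?Z"
        by blast
      have "\<not> R x (f j)" if "j \<in> ?S" for j
      proof
        assume "R x (f j)"
        then have "(SOME x. x \<in> C i \<and> R x (f j)) = x"
          using x thin[OF True] by (intro some_equality) auto
        then show False
          using x that by blast
      qed
      with x show ?thesis
        by (auto simp: P_def)
    qed (simp add: P_def)
  qed
  then obtain f where f: "P f i (f i)" for i
    by blast
  show ?thesis
  proof
    show "f i \<in> C i" if "i \<in> I" for i
      using f[of i] that by (simp add: P_def)
    fix i j assume ij: "i \<in> I" "j \<in> I" "i \<noteq> j"
    then have "(i, j) \<in> ?r \<or> (j, i) \<in> ?r"
      using wo by (auto simp: well_order_on_def linear_order_on_def total_on_def)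
    then have "i \<in> underS ?r j \<or> j \<in> underS ?r i"
      using ij by (auto simp: underS_def)
    then show "\<not> R (f i) (f j)"
      using f[of i] f[of j] ij sym by (auto simp: P_def)
  qed
qed

text \<open>
  A closed set is determined by the members of a countable base that are disjoint from it.
\<close>
lemma closed_sets_lepoll_real: "{B :: 'a::second_countable_topology set. closed B} \<lesssim> (UNIV :: real set)"
proof -
  obtain \<B> :: "'a set set" where \<B>: "countable \<B>" "topological_basis \<B>"
    using ex_countable_basis by blast
  let ?c = "\<lambda>B. {n. from_nat_into \<B> n \<subseteq> - B}"
  have "inj_on ?c {B. closed B}"
  proof (rule inj_onI)
    fix A B assume AB: "A \<in> {B. closed B}" "B \<in> {B. closed B}" "?c A = ?c B"
    have "- C = (\<Union>n \<in> ?c C. from_nat_into \<B> n)" if C: "closed C" for C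
    proof
      show "- C \<subseteq> (\<Union>n \<in> ?c C. from_nat_into \<B> n)"
      proof
        fix x assume "x \<in> - C"
        then obtain V where "V \<in> \<B>" "x \<in> V" "V \<subseteq> - C"
          using topological_basisE[OF \<B>(2) open_Compl[OF C]] by metis
        then show "x \<in> (\<Union>n \<in> ?c C. from_nat_into \<B> n)"
          using from_nat_into_surj[OF \<B>(1) \<open>V \<in> \<B>\<close>] by blast
      qed
    qed auto
    then have "- A = - B"
      using AB by (metis mem_Collect_eq)
    then show "A = B"
      by simp
  qed
  then have "{B :: 'a set. closed B} \<lesssim> (UNIV :: nat set set)"
    unfolding lepoll_def by (intro exI[of _ ?c]) auto
  also have "\<dots> \<lesssim> {0..<1::real}"
    by (rule nat_sets_lepoll_reals01)
  also have "\<dots> \<lesssim> (UNIV :: real set)"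
    by (simp add: subset_imp_lepoll)
  finally show ?thesis .
qed

text \<open>
  The Cantor--Bendixson argument: removing from \<open>B\<close> the countably many points that have a
  neighbourhood meeting \<open>B\<close> in a countable set leaves a nonempty perfect set, and perfect sets in a
  complete metric space have at least the cardinality of the continuum.
\<close>
lemma real_lepoll_uncountable_closed:
  fixes B :: "'a::polish_space set"
  assumes "closed B" "uncountable B"
  shows "(UNIV :: real set) \<lesssim> B"
proof -
  define K where "K = {x. \<forall>U. open U \<and> x \<in> U \<longrightarrow> uncountable (U \<inter> B)}"
  obtain \<B> :: "'a set set" where \<B>: "countable \<B>" "topological_basis \<B>"
    using ex_countable_basis by blast
  have "B - K \<subseteq> (\<Union>V \<in> {V \<in> \<B>. countable (V \<inter> B)}. V \<inter> B)"
  proof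
    fix x assume x: "x \<in> B - K"
    then obtain U where U: "open U" "x \<in> U" "countable (U \<inter> B)"
      by (auto simp: K_def)
    then obtain V where "V \<in> \<B>" "x \<in> V" "V \<subseteq> U"
      using topological_basisE[OF \<B>(2)] by metis
    moreover from this have "countable (V \<inter> B)"
      using U(3) by (meson Int_mono countable_subset order_refl)
    ultimately show "x \<in> (\<Union>V \<in> {V \<in> \<B>. countable (V \<inter> B)}. V \<inter> B)"
      using x by blast
  qed
  moreover have "countable (\<Union>V \<in> {V \<in> \<B>. countable (V \<inter> B)}. V \<inter> B)"
    using \<B>(1) by (intro countable_UN) (auto intro: countable_subset)
  ultimately have BK: "countable (B - K)"
    using countable_subset by blast
  have "K \<subseteq> B"
  proof
    fix x assume "x \<in> K"
    then show "x \<in> B"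
      using assms(1) by (auto simp: K_def open_Compl dest!: spec[of _ "- B"])
  qed
  have unc: "uncountable (U \<inter> K)" if "open U" "x \<in> U" "x \<in> K" for U x
  proof
    assume "countable (U \<inter> K)"
    then have "countable ((U \<inter> K) \<union> (B - K))"
      using BK by blast
    then have "countable (U \<inter> B)"
      by (rule countable_subset[rotated]) auto
    then show False
      using that by (auto simp: K_def)
  qed
  have "euclidean derived_set_of K = K"
  proof
    show "K \<subseteq> euclidean derived_set_of K"
    proof
      fix x assume "x \<in> K"
      have "\<exists>y. y \<noteq> x \<and> y \<in> K \<and> y \<in> T" if "x \<in> T" "open T" for T
      proof (rule ccontr)
        assume "\<not> ?thesis"
        then have "T \<inter> K \<subseteq> {x}"
          by auto
        then show False
          using unc[OF that(2,1) \<open>x \<in> K\<close>] by (meson countable_finite countable_subset finite.simps)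
      qed
      then show "x \<in> euclidean derived_set_of K"
        by (auto simp: in_derived_set_of)
    qed
    show "euclidean derived_set_of K \<subseteq> K"
    proof
      fix x assume x: "x \<in> euclidean derived_set_of K"
      have "uncountable (U \<inter> B)" if "open U" "x \<in> U" for U
      proof -
        have "\<exists>y. y \<noteq> x \<and> y \<in> K \<and> y \<in> U"
          using x that by (simp add: in_derived_set_of)
        then obtain y where "y \<in> K" "y \<in> U"
          by auto
        then show ?thesis
          using that by (auto simp: K_def)
      qed
      then show "x \<in> K"
        by (auto simp: K_def)
    qed
  qed
  moreover have "K \<noteq> {}"
    using BK assms(2) by auto
  ultimately have "(UNIV :: real set) \<lesssim> K"
    by (intro lepoll_perfect_set[of euclidean]) (auto simp: completely_metrizable_space_euclidean)
  also have "K \<lesssim> B"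
    using \<open>K \<subseteq> B\<close> by (rule subset_imp_lepoll)
  finally show ?thesis .
qed

section \<open>Independent Cantor sets in abelian Polish groups\<close>

definition small_multiples :: "'a::group_add \<Rightarrow> 'a set" where
  "small_multiples c = {0, c, - c, c + c, - (c + c)}"

text \<open>
  \<open>F n\<close> collects the possible values of \<open>\<Sum>k<n. e\<^sub>k c\<^sub>k\<close> with \<open>\<bar>e\<^sub>k\<bar> \<le> 2\<close>. Distances are bounded stage by
  stage over the finite sets \<open>F n\<close>, because the complete metric need not be translation invariant.
  The bound \<open>r n\<close> on the step at stage \<open>n\<close> is fixed when \<open>F n\<close> is known, so that all later steps
  together (at most \<open>2 * r n\<close>) cannot lead from a nonzero element of \<open>F n\<close> to \<open>0\<close>.
\<close>
locale lacunary =
  fixes c :: "nat \<Rightarrow> 'a::{complete_space, topological_ab_group_add}"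
    and r :: "nat \<Rightarrow> real" and F :: "nat \<Rightarrow> 'a set"
  assumes F_0: "F 0 = {0}"
    and F_Suc: "F (Suc n) = (\<Union>s \<in> F n. (\<lambda>d. s + d) ` small_multiples (c n))"
    and r_pos: "0 < r n"
    and r_Suc: "r (Suc n) \<le> r n / 2"
    and step_small: "\<lbrakk>s \<in> F n; d \<in> small_multiples (c n)\<rbrakk> \<Longrightarrow> dist s (s + d) < r n"
    and far: "\<lbrakk>s \<in> F (Suc n); s \<noteq> 0\<rbrakk> \<Longrightarrow> 2 * r (Suc n) < dist s 0"
    and new: "s \<in> F n \<Longrightarrow> s + c n \<noteq> 0 \<and> s - c n \<noteq> 0"
begin

text \<open>
  The sequences of partial sums \<open>\<Sum>k<n. e\<^sub>k c\<^sub>k\<close> with integers \<open>\<bar>e\<^sub>k\<bar> \<le> 2\<close>, described by their increments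
  to avoid integer multiples in a group.
\<close>
definition walk :: "(nat \<Rightarrow> 'a) \<Rightarrow> bool" where
  "walk s \<longleftrightarrow> s 0 = 0 \<and> (\<forall>n. s (Suc n) - s n \<in> small_multiples (c n))"

lemma walk_in:
  assumes "walk s" shows "s n \<in> F n"
proof (induction n)
  case (Suc n)
  have "s (Suc n) = s n + (s (Suc n) - s n)"
    by simp
  with Suc show ?case
    using assms unfolding F_Suc walk_def by blast
qed (use assms in \<open>simp add: walk_def F_0\<close>)

text \<open>
  The steps from stage \<open>m\<close> on form a series dominated by the geometric series with first term \<open>r m\<close>.
\<close>
lemma walk_dist:
  assumes "walk s" "m \<le> n" shows "dist (s m) (s n) \<le> 2 * r m"
proof -
  \<comment> \<open>Subtracting \<open>2 * r (m + k)\<close> leaves room for the remaining steps in the induction.\<close>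
  have "dist (s m) (s (m + k)) \<le> 2 * r m - 2 * r (m + k)" for k
  proof (induction k)
    case (Suc k)
    have "dist (s (m + k)) (s (m + k) + (s (Suc (m + k)) - s (m + k))) < r (m + k)"
      using assms(1) by (intro step_small walk_in) (auto simp: walk_def)
    then have "dist (s (m + k)) (s (Suc (m + k))) < r (m + k)"
      by simp
    with Suc r_Suc[of "m + k"] dist_triangle[of "s m" "s (m + Suc k)" "s (m + k)"] show ?case
      by simp
  qed simp
  from this[of "n - m"] r_pos[of n] assms(2) show ?thesis
    by simp
qed

lemma r_le: "r n \<le> r 0 / 2 ^ n"
proof (induction n)
  case (Suc n)
  then have "r n / 2 \<le> r 0 / 2 ^ n / 2"
    by (rule divide_right_mono) simp
  with r_Suc[of n] show ?case
    by (simp add: mult.commute)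
qed simp

lemma r_tendsto_0: "r \<longlonglongrightarrow> 0"
proof (rule tendsto_sandwich)
  show "eventually (\<lambda>n. 0 \<le> r n) sequentially"
    using r_pos by (simp add: less_imp_le)
  show "eventually (\<lambda>n. r n \<le> r 0 / 2 ^ n) sequentially"
    using r_le by simp
  show "(\<lambda>n. r 0 / 2 ^ n) \<longlonglongrightarrow> 0"
    using tendsto_mult[OF tendsto_const[of "r 0"] LIMSEQ_power_zero[of "1/2::real"]]
    by (simp add: power_divide)
qed simp

lemma walk_convergent:
  assumes "walk s" shows "convergent s"
proof -
  have "Cauchy s"
  proof (rule metric_CauchyI)
    fix e :: real assume "0 < e"
    then have "eventually (\<lambda>n. r n < e / 4) sequentially"
      by (intro order_tendstoD[OF r_tendsto_0]) simp
    then obtain N where N: "r N < e / 4"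
      using eventually_happens'[OF sequentially_bot] by blast
    have "dist (s m) (s n) < e" if "N \<le> m" "N \<le> n" for m n
      using walk_dist[OF assms that(1)] walk_dist[OF assms that(2)] N
        dist_triangle3[of "s m" "s n" "s N"] by simp
    then show "\<exists>N. \<forall>m\<ge>N. \<forall>n\<ge>N. dist (s m) (s n) < e"
      by blast
  qed
  then show ?thesis
    by (simp add: Cauchy_convergent_iff)
qed

lemma walk_dist_lim:
  assumes "walk s" "s \<longlonglongrightarrow> L" shows "dist (s n) L \<le> 2 * r n"
proof (rule tendsto_upperbound)
  show "(\<lambda>k. dist (s n) (s k)) \<longlonglongrightarrow> dist (s n) L"
    by (intro tendsto_intros assms(2))
  show "eventually (\<lambda>k. dist (s n) (s k) \<le> 2 * r n) sequentially"
    using walk_dist[OF assms(1)] eventually_sequentially by blast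
qed simp

text \<open>
  This plays the part of linear independence. Stage \<open>n\<close> cannot be left at \<open>0\<close>, since \<open>c n\<close> is not
  the negative of a value attainable before; later steps are too short to return to \<open>0\<close>. A step
  \<open>\<plusminus>(c n + c n)\<close> would give no such conclusion, as \<open>c n\<close> may have order two.
\<close>
lemma walk_lim_nonzero:
  assumes "walk s" "s \<longlonglongrightarrow> L" and step: "s (Suc n) - s n = c n \<or> s (Suc n) - s n = - c n"
  shows "L \<noteq> 0"
proof -
  have "s (Suc n) = s n + c n \<or> s (Suc n) = s n - c n"
    using step by (auto simp: algebra_simps)
  then have "s (Suc n) \<noteq> 0"
    using new[OF walk_in[OF assms(1), of n]] by auto
  then have "2 * r (Suc n) < dist (s (Suc n)) 0"
    using far walk_in[OF assms(1)] by blast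
  then show ?thesis
    using walk_dist_lim[OF assms(1,2), of "Suc n"] by auto
qed

definition partial_sum :: "(nat \<Rightarrow> bool) \<Rightarrow> nat \<Rightarrow> 'a" where
  "partial_sum w n = (\<Sum>k<n. if w k then c k else 0)"

definition subsum :: "(nat \<Rightarrow> bool) \<Rightarrow> 'a" where
  "subsum w = lim (partial_sum w)"

lemma walk_partial_sum: "walk (partial_sum w)"
  by (auto simp: walk_def partial_sum_def small_multiples_def)

lemma partial_sum_tendsto: "partial_sum w \<longlonglongrightarrow> subsum w"
  using walk_convergent[OF walk_partial_sum] by (simp add: subsum_def convergent_LIMSEQ_iff)

lemma continuous_partial_sum: "continuous_on UNIV (\<lambda>w. partial_sum w n)"
  unfolding partial_sum_def
proof (intro continuous_on_sum)
  fix k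
  have "continuous_on UNIV ((\<lambda>b. if b then c k else 0) \<circ> (\<lambda>w :: nat \<Rightarrow> bool. w k))"
    by (intro continuous_on_compose Topological_Spaces.continuous_on_discrete continuous_on_product_coordinates)
  then show "continuous_on UNIV (\<lambda>w :: nat \<Rightarrow> bool. if w k then c k else 0)"
    by (simp add: o_def)
qed

text \<open>
  The tail bound \<open>2 * r n\<close> does not depend on the index set, so the convergence is uniform.
\<close>
lemma continuous_subsum: "continuous_on UNIV subsum"
proof (rule uniform_limit_theorem)
  show "uniform_limit UNIV (\<lambda>n w. partial_sum w n) subsum sequentially"
  proof (rule uniform_limitI)
    fix e :: real assume "0 < e"
    then have "eventually (\<lambda>n. r n < e / 2) sequentially"
      by (intro order_tendstoD[OF r_tendsto_0]) simp
    then show "eventually (\<lambda>n. \<forall>w\<in>UNIV. dist (partial_sum w n) (subsum w) < e) sequentially"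
    proof eventually_elim
      case (elim n)
      then show ?case
        using le_less_trans[OF walk_dist_lim[OF walk_partial_sum partial_sum_tendsto, of _ n], of e]
        by simp
    qed
  qed
qed (simp_all add: continuous_partial_sum)

text \<open>
  In the difference of both sides the coefficients at indices in \<open>J\<close> lie in \<open>{-1, 0, 1}\<close> and come from
  \<open>w\<close> and \<open>w'\<close> alone; those outside \<open>J\<close> are at most two in absolute value. An index at which \<open>w\<close>
  and \<open>w'\<close> differ has coefficient \<open>\<plusminus>1\<close>, which forbids the sum \<open>0\<close>.
\<close>
lemma subsum_independent:
  assumes w: "{k. w k} \<subseteq> J" "{k. w' k} \<subseteq> J"
    and p: "{k. p1 k} \<subseteq> - J" "{k. p2 k} \<subseteq> - J" "{k. p3 k} \<subseteq> - J" "{k. p4 k} \<subseteq> - J"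
    and eq: "subsum w - subsum w' = (subsum p1 - subsum p2) - (subsum p3 - subsum p4)"
  shows "w = w'"
proof (rule ccontr)
  assume "w \<noteq> w'"
  then obtain n where n: "w n \<noteq> w' n"
    by blast
  define s where "s n = (partial_sum w n - partial_sum w' n) -
    ((partial_sum p1 n - partial_sum p2 n) - (partial_sum p3 n - partial_sum p4 n))" for n
  have step: "s (Suc k) - s k = ((if w k then c k else 0) - (if w' k then c k else 0)) -
    (((if p1 k then c k else 0) - (if p2 k then c k else 0)) -
     ((if p3 k then c k else 0) - (if p4 k then c k else 0)))" for k
    unfolding s_def partial_sum_def by (simp add: algebra_simps)
  have J: "\<not> p1 k \<and> \<not> p2 k \<and> \<not> p3 k \<and> \<not> p4 k" if "k \<in> J" for k
    using p that by auto
  have notJ: "\<not> w k \<and> \<not> w' k" if "k \<notin> J" for k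
    using w that by auto
  have "s (Suc k) - s k \<in> small_multiples (c k)" for k
  proof (cases "k \<in> J")
    case True
    then show ?thesis
      unfolding step using J[OF True] by (simp add: small_multiples_def)
  next
    case False
    then show ?thesis
      unfolding step using notJ[OF False] by (simp add: small_multiples_def)
  qed
  moreover have "s 0 = 0"
    by (simp add: s_def partial_sum_def)
  ultimately have "walk s"
    by (simp add: walk_def)
  moreover have "s \<longlonglongrightarrow> (subsum w - subsum w') - ((subsum p1 - subsum p2) - (subsum p3 - subsum p4))"
    unfolding s_def by (intro tendsto_diff partial_sum_tendsto)
  moreover have "s (Suc n) - s n = c n \<or> s (Suc n) - s n = - c n"
  proof -
    have "n \<in> J"
      using n w by auto
    then show ?thesis
      unfolding step using J[OF \<open>n \<in> J\<close>] n by simp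
  qed
  ultimately have "(subsum w - subsum w') - ((subsum p1 - subsum p2) - (subsum p3 - subsum p4)) \<noteq> 0"
    by (rule walk_lim_nonzero)
  with eq show False
    by simp
qed

lemma inj_subsum: "inj subsum"
proof (rule injI)
  fix w w' assume "subsum w = subsum w'"
  then show "w = w'"
    by (intro subsum_independent[of w UNIV w' "\<lambda>_. False" "\<lambda>_. False" "\<lambda>_. False" "\<lambda>_. False"]) auto
qed

end

text \<open>
  Otherwise all singletons would be open, hence members of any countable base.
\<close>
lemma zero_islimpt_UNIV:
  assumes "uncountable (UNIV :: 'a::{second_countable_topology, topological_group_add} set)"
  shows "(0 :: 'a) islimpt UNIV"
proof (rule ccontr)
  assume "\<not> (0 :: 'a) islimpt UNIV"
  then have op: "open {0 :: 'a}"
    by (simp add: islimpt_UNIV_iff)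
  have op': "open {x}" for x :: 'a
  proof -
    have "open ((\<lambda>y. y - x) -` {0})"
      by (intro open_vimage op continuous_intros)
    also have "(\<lambda>y. y - x) -` {0} = {x}"
      by auto
    finally show ?thesis .
  qed
  obtain \<B> :: "'a set set" where \<B>: "countable \<B>" "topological_basis \<B>"
    using ex_countable_basis by blast
  have "{x} \<in> \<B>" for x
    using topological_basisE[OF \<B>(2) op', of x x] by (metis singletonI subset_singletonD empty_iff)
  then have "countable (range (\<lambda>x::'a. {x}))"
    by (intro countable_subset[OF _ \<B>(1)]) auto
  then show False
    using assms by (simp add: countable_image_inj_eq)
qed

text \<open>
  All requirements on \<open>c\<close> hold for every \<open>c \<noteq> 0\<close> close enough to \<open>0\<close>: the first by continuity, the
  second because it excludes only finitely many values.
\<close>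
lemma lacunary_step:
  fixes F :: "'a::{metric_space, topological_group_add} set"
  assumes lim: "(0 :: 'a) islimpt UNIV" and "finite F" "0 < r"
  obtains c where "\<forall>s \<in> F. \<forall>d \<in> small_multiples c. dist s (s + d) < r"
    and "\<forall>s \<in> F. s + c \<noteq> 0 \<and> s - c \<noteq> 0"
proof -
  have "eventually (\<lambda>c. \<forall>s \<in> F. \<forall>d \<in> small_multiples c. dist s (s + d) < r) (at 0)"
  proof -
    have "eventually (\<lambda>c. dist s (s + f c) < r) (at 0)"
      if "(f \<longlongrightarrow> 0) (at 0)" for s :: 'a and f :: "'a \<Rightarrow> 'a"
    proof -
      have "((\<lambda>c. dist s (s + f c)) \<longlongrightarrow> dist s (s + 0)) (at 0)"
        by (intro tendsto_intros that)
      then show ?thesis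
        using \<open>0 < r\<close> by (intro order_tendstoD) auto
    qed
    note * = this
    have t1: "((\<lambda>c::'a. - c) \<longlongrightarrow> 0) (at 0)" and t2: "((\<lambda>c::'a. c + c) \<longlongrightarrow> 0) (at 0)"
      and t3: "((\<lambda>c::'a. - (c + c)) \<longlongrightarrow> 0) (at 0)"
      by (auto intro!: tendsto_eq_intros)
    have "eventually (\<lambda>c. \<forall>d \<in> small_multiples c. dist s (s + d) < r) (at 0)" for s :: 'a
      unfolding small_multiples_def
      using *[OF tendsto_const, of s] *[OF tendsto_ident_at, of s] *[OF t1, of s] *[OF t2, of s] *[OF t3, of s]
      by eventually_elim auto
    then show ?thesis
      using \<open>finite F\<close> by (simp add: eventually_ball_finite_distrib)
  qed
  moreover have "eventually (\<lambda>c. \<forall>s \<in> F. s + c \<noteq> 0 \<and> s - c \<noteq> 0) (at 0)"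
  proof -
    have "finite (F \<union> uminus ` F)"
      using \<open>finite F\<close> by simp
    then have "eventually (\<lambda>c. \<forall>a \<in> F \<union> uminus ` F. c \<noteq> a) (at 0)"
      by (subst eventually_ball_finite_distrib) (auto intro: eventually_neq_at_within)
    then show ?thesis
    proof eventually_elim
      case (elim c)
      then show ?case
        by (metis UnI1 UnI2 add.inverse_inverse add_eq_0_iff eq_iff_diff_eq_0 image_eqI)
    qed
  qed
  ultimately have "eventually (\<lambda>c. (\<forall>s \<in> F. \<forall>d \<in> small_multiples c. dist s (s + d) < r) \<and>
      (\<forall>s \<in> F. s + c \<noteq> 0 \<and> s - c \<noteq> 0)) (at 0)"
    by eventually_elim blast
  moreover have "at (0 :: 'a) \<noteq> bot"
    using lim by (simp add: trivial_limit_within)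
  ultimately obtain c where "(\<forall>s \<in> F. \<forall>d \<in> small_multiples c. dist s (s + d) < r) \<and>
      (\<forall>s \<in> F. s + c \<noteq> 0 \<and> s - c \<noteq> 0)"
    using eventually_happens' by blast
  then show ?thesis
    using that by blast
qed

lemma lacunary_exists:
  assumes lim: "(0 :: 'a::{complete_space, topological_ab_group_add}) islimpt UNIV"
  obtains c :: "nat \<Rightarrow> 'a::{complete_space, topological_ab_group_add}" and r F where "lacunary c r F"
proof -
  \<comment> \<open>A state \<open>(F, r, c)\<close> holds the values at one stage; \<open>Q\<close> relates consecutive stages.\<close>
  define P where "P n x \<longleftrightarrow> (case x of (F, r, c :: 'a) \<Rightarrow> finite F \<and> 0 < r \<and> (n = 0 \<longrightarrow> F = {0}) \<and>
      (\<forall>s \<in> F. \<forall>d \<in> small_multiples c. dist s (s + d) < r) \<and>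
      (\<forall>s \<in> F. s + c \<noteq> 0 \<and> s - c \<noteq> 0))" for n :: nat and x :: "'a set \<times> real \<times> 'a"
  define Q where "Q x y \<longleftrightarrow> (case x of (F, r, c :: 'a) \<Rightarrow> case y of (F', r', c' :: 'a) \<Rightarrow>
      F' = (\<Union>s \<in> F. (\<lambda>d. s + d) ` small_multiples c) \<and> r' \<le> r / 2 \<and>
      (\<forall>s \<in> F'. s \<noteq> 0 \<longrightarrow> 2 * r' < dist s 0))" for x y :: "'a set \<times> real \<times> 'a"
  have "\<exists>f. \<forall>n. P n (f n) \<and> Q (f n) (f (Suc n))"
  proof (rule dependent_nat_choice)
    obtain c :: 'a where "\<forall>s \<in> {0}. \<forall>d \<in> small_multiples c. dist s (s + d) < 1"
      "\<forall>s \<in> {0}. s + c \<noteq> 0 \<and> s - c \<noteq> 0"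
      using lacunary_step[OF lim, of "{0}" 1] by auto
    then have "P 0 ({0}, 1, c)"
      by (simp add: P_def)
    then show "\<exists>x. P 0 x" ..
  next
    fix x n assume Px: "P n x"
    obtain F r c where x: "x = (F, r, c)"
      by (cases x)
    define F' where "F' = (\<Union>s \<in> F. (\<lambda>d. s + d) ` small_multiples c)"
    have fin: "finite F'"
      using Px by (simp add: x P_def F'_def small_multiples_def)
    \<comment> \<open>One third of \<open>m\<close> satisfies \<open>far\<close> strictly and is below half of the previous radius.\<close>
    define m where "m = Min (insert r ((\<lambda>s. dist s 0) ` (F' - {0})))"
    have "0 < m"
      unfolding m_def using fin Px by (subst Min_gr_iff) (auto simp: x P_def)
    have m: "m \<le> r" "s \<in> F' \<Longrightarrow> s \<noteq> 0 \<Longrightarrow> m \<le> dist s 0" for s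
      unfolding m_def using fin by (auto intro!: Min_le)
    have "0 < m / 3"
      using \<open>0 < m\<close> by simp
    then obtain c' where "\<forall>s \<in> F'. \<forall>d \<in> small_multiples c'. dist s (s + d) < m / 3"
      "\<forall>s \<in> F'. s + c' \<noteq> 0 \<and> s - c' \<noteq> 0"
      using lacunary_step[OF lim fin] by metis
    then have "P (Suc n) (F', m / 3, c')"
      using fin \<open>0 < m\<close> by (simp add: P_def)
    moreover have "Q x (F', m / 3, c')"
      using m \<open>0 < m\<close> by (force simp: Q_def x F'_def[symmetric])
    ultimately show "\<exists>y. P (Suc n) y \<and> Q x y"
      by blast
  qed
  then obtain f where "\<forall>n. P n (f n) \<and> Q (f n) (f (Suc n))" ..
  then have f: "P n (f n)" "Q (f n) (f (Suc n))" for n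
    by simp_all
  have "lacunary (\<lambda>n. snd (snd (f n))) (\<lambda>n. fst (snd (f n))) (\<lambda>n. fst (f n))"
  proof
    fix n s
    show "fst (f 0) = {0}"
      using f(1)[of 0] by (simp add: P_def case_prod_beta)
    show "fst (f (Suc n)) = (\<Union>s\<in>fst (f n). (+) s ` small_multiples (snd (snd (f n))))"
      using f(2)[of n] by (simp add: Q_def case_prod_beta)
    show "0 < fst (snd (f n))"
      using f(1)[of n] by (simp add: P_def case_prod_beta)
    show "fst (snd (f (Suc n))) \<le> fst (snd (f n)) / 2"
      using f(2)[of n] by (simp add: Q_def case_prod_beta)
    show "dist s (s + d) < fst (snd (f n))"
      if "s \<in> fst (f n)" "d \<in> small_multiples (snd (snd (f n)))" for d
      using f(1)[of n] that by (simp add: P_def case_prod_beta)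
    show "2 * fst (snd (f (Suc n))) < dist s 0" if "s \<in> fst (f (Suc n))" "s \<noteq> 0"
      using f(2)[of n] that by (simp add: Q_def case_prod_beta)
    show "s + snd (snd (f n)) \<noteq> 0 \<and> s - snd (snd (f n)) \<noteq> 0" if "s \<in> fst (f n)"
      using f(1)[of n] that by (simp add: P_def case_prod_beta)
  qed
  then show ?thesis
    using that by blast
qed

section \<open>Measures on Cantor sets and their translates\<close>

lemma compact_cantor_subsets: "compact {w :: nat \<Rightarrow> bool. {k. w k} \<subseteq> J}"
proof -
  have "compact_space (euclidean :: bool topology)"
    by (simp add: compact_space_def compactin_euclidean_iff finite_imp_compact)
  then have "compact_space (product_topology (\<lambda>_ :: nat. euclidean :: bool topology) UNIV)"
    by (simp add: compact_space_product_topology)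
  then have "compact (UNIV :: (nat \<Rightarrow> bool) set)"
    by (simp add: euclidean_product_topology compact_space_def compactin_euclidean_iff)
  moreover have "closed {w :: nat \<Rightarrow> bool. {k. w k} \<subseteq> J}"
  proof -
    have "{w :: nat \<Rightarrow> bool. {k. w k} \<subseteq> J} = (\<Inter>k \<in> - J. {w. w k = False})"
      by auto
    also have "closed \<dots>"
      by (intro closed_INT ballI closed_Collect_eq continuous_on_product_coordinates continuous_on_const)
    finally show ?thesis .
  qed
  ultimately show ?thesis
    using compact_Int_closed by fastforce
qed

instance bool :: second_countable_topology
proof
  have "(open :: bool set \<Rightarrow> bool) = generate_topology UNIV"
    by (rule ext) (simp add: discrete_topology_class.open_discrete generate_topology.Basis)
  then show "\<exists>B :: bool set set. countable B \<and> open = generate_topology B"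
    by (intro exI[of _ UNIV]) (simp add: countable_finite)
qed

lemma borel_measurable_bool:
  fixes P :: "'a \<Rightarrow> bool"
  assumes [measurable]: "Measurable.pred M P"
  shows "P \<in> borel_measurable M"
proof (rule borel_measurableI)
  fix S :: "bool set"
  have "P x \<in> S \<longleftrightarrow> True \<in> S \<and> P x \<or> False \<in> S \<and> \<not> P x" for x
    by (cases "P x") auto
  then have "P -` S \<inter> space M =
      {x \<in> space M. True \<in> S \<and> P x} \<union> {x \<in> space M. False \<in> S \<and> \<not> P x}"
    by auto
  also have "\<dots> \<in> sets M"
    by measurable
  finally show "P -` S \<inter> space M \<in> sets M" .
qed

text \<open>
  The Cantor set of subsets of \<open>J\<close> receives the uniform distribution on the unit interval through
  Dedekind cuts: with the rationals indexed by \<open>J\<close>, a real \<open>x\<close> is sent to the set of indices of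
  rationals below \<open>x\<close>. This map is injective, so points remain null.
\<close>
lemma atomless_prob_on_cantor_image:
  fixes f :: "(nat \<Rightarrow> bool) \<Rightarrow> 'a::t2_space"
  assumes cont: "continuous_on UNIV f" and "inj f" and "infinite J"
  obtains \<mu> where "borel_prob \<mu>" and "\<And>x. {x} \<in> null_sets \<mu>"
    and "- f ` {w. {k. w k} \<subseteq> J} \<in> null_sets \<mu>"
proof -
  define q where "q k = (from_nat_into \<rat> (to_nat_on J k) :: real)" for k
  have q: "\<exists>k \<in> J. q k = x" if "x \<in> \<rat>" for x :: real
  proof -
    have "bij_betw (to_nat_on J) J UNIV"
      by (intro to_nat_on_infinite countableI_type \<open>infinite J\<close>)
    moreover obtain n where "from_nat_into \<rat> n = x"
      using from_nat_into_surj[OF countable_rat \<open>x \<in> \<rat>\<close>] by blast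
    ultimately show ?thesis
      by (metis UNIV_I bij_betw_imp_surj_on imageE q_def)
  qed
  define cut where "cut x = (\<lambda>k. k \<in> J \<and> q k < x)" for x :: real
  have inj_cut: "inj cut"
  proof (rule linorder_injI)
    fix x y :: real assume "x < y"
    then obtain z where "z \<in> \<rat>" "x < z" "z < y"
      using Rats_dense_in_real by blast
    moreover from this obtain k where "k \<in> J" "q k = z"
      using q by blast
    ultimately have "cut x k \<noteq> cut y k"
      by (simp add: cut_def)
    then show "cut x \<noteq> cut y"
      by metis
  qed
  have "(\<lambda>x. cut x) \<in> borel_measurable borel"
    unfolding cut_def
    by (intro measurable_coordinatewise_then_product borel_measurable_bool) measurable
  then have meas: "(\<lambda>x. f (cut x)) \<in> borel_measurable borel"
    using borel_measurable_continuous_onI[OF cont] by (rule measurable_compose)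
  define u where "u = uniform_measure lborel {0..1::real}"
  interpret u: prob_space u
    unfolding u_def by (rule prob_space_uniform_measure) auto
  have meas_u: "(\<lambda>x. f (cut x)) \<in> measurable u borel"
    using meas by (simp add: u_def)
  have sets_u: "sets u = sets borel" "space u = UNIV"
    by (simp_all add: u_def)
  have null_u: "{x} \<in> null_sets u" for x
    unfolding u_def by (intro null_setsI) (auto simp: emeasure_lborel_countable intro: emeasure_eq_0[of "{x}"])
  let ?\<mu> = "distr u borel (\<lambda>x. f (cut x))"
  show ?thesis
  proof
    show "borel_prob ?\<mu>"
      using u.prob_space_distr[OF meas_u] by (simp add: borel_prob_def)
    show "{x} \<in> null_sets ?\<mu>" for x
    proof -
      have "(\<lambda>x. f (cut x)) -` {x} \<in> null_sets u"
      proof (cases "\<exists>z. f (cut z) = x")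
        case True
        then obtain z where "f (cut z) = x" ..
        then have "(\<lambda>x. f (cut x)) -` {x} = {z}"
          using injD[OF \<open>inj f\<close>] injD[OF inj_cut] by blast
        then show ?thesis
          using null_u by simp
      next
        case False
        then have "(\<lambda>x. f (cut x)) -` {x} = {}"
          by blast
        then show ?thesis
          by simp
      qed
      then show ?thesis
        using meas_u by (simp add: null_sets_distr_iff sets_u)
    qed
    have "compact (f ` {w. {k. w k} \<subseteq> J})"
      by (intro compact_continuous_image compact_cantor_subsets continuous_on_subset[OF cont]) simp
    then have "- f ` {w. {k. w k} \<subseteq> J} \<in> sets borel"
      by (simp add: compact_imp_closed open_Compl)
    moreover have "(\<lambda>x. f (cut x)) -` (- f ` {w. {k. w k} \<subseteq> J}) = {}"
      by (auto simp: cut_def)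
    ultimately show "- f ` {w. {k. w k} \<subseteq> J} \<in> null_sets ?\<mu>"
      using meas_u by (simp add: null_sets_distr_iff sets_u)
  qed
qed

text \<open>
  The convolution \<open>m\<close> of \<open>\<nu>\<close> and \<open>\<rho>\<close> is an average of translates of \<open>\<nu>\<close>, so the Borel kernel \<open>S\<close> of
  \<open>U\<close> has \<open>m\<close>-measure zero. As \<open>U\<close> is \<open>m\<close>-measurable, so has a Borel hull of \<open>U\<close>. But \<open>m\<close> is also
  an average of translates of \<open>\<rho>\<close>, and almost all of these must give measure zero to the hull.
\<close>
lemma translate_avoids_almost_surely:
  fixes U :: "'a::{second_countable_topology, topological_group_add} set"
  assumes U: "universally_measurable U" and \<nu>: "borel_prob \<nu>" and \<rho>: "borel_prob \<rho>"
    and null: "\<And>g h. (\<lambda>x. g + x + h) ` U \<in> null_sets (completion \<nu>)"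
  obtains x V where "V \<in> sets borel" "U \<subseteq> V" "{y. x + y \<in> V} \<in> null_sets \<rho>"
proof -
  interpret \<nu>: prob_space \<nu>
    using \<nu> by (simp add: borel_prob_def)
  interpret \<rho>: prob_space \<rho>
    using \<rho> by (simp add: borel_prob_def)
  interpret pair_prob_space \<nu> \<rho> ..
  have sets[measurable_cong]: "sets \<nu> = sets borel" "sets \<rho> = sets borel"
    using \<nu> \<rho> by (simp_all add: borel_prob_def)
  have space: "space \<nu> = UNIV" "space \<rho> = UNIV"
    using sets[THEN sets_eq_imp_space_eq] by simp_all
  define m where "m = distr (\<nu> \<Otimes>\<^sub>M \<rho>) borel (\<lambda>z. fst z + snd z)"
  have add: "(\<lambda>z. fst z + snd z) \<in> measurable (\<nu> \<Otimes>\<^sub>M \<rho>) borel"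
    by measurable
  have "borel_prob m"
    unfolding borel_prob_def m_def using prob_space_distr[OF add] by simp
  then have "U \<in> sets (completion m)"
    using U by (simp add: universally_measurable_def)
  then obtain S N N' where SN: "U = S \<union> N" "N \<subseteq> N'" "N' \<in> null_sets m" "S \<in> sets m"
    by (rule sets_completionE)
  have S[measurable]: "S \<in> sets borel"
    using SN(4) by (simp add: m_def)
  have vimage: "(\<lambda>z. fst z + snd z) -` A \<inter> space (\<nu> \<Otimes>\<^sub>M \<rho>) \<in> sets (\<nu> \<Otimes>\<^sub>M \<rho>)"
    if "A \<in> sets borel" for A
    using measurable_sets[OF add that] .
  have "emeasure m S = (\<integral>\<^sup>+ y. emeasure \<nu> {x. x + y \<in> S} \<partial>\<rho>)"
    using S vimage[OF S] by (simp add: m_def emeasure_distr[OF add] emeasure_pair_measure_alt2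
        space space_pair_measure vimage_def)
  also have "\<dots> = (\<integral>\<^sup>+ y. 0 \<partial>\<rho>)"
  proof (rule nn_integral_cong)
    fix y
    have "{x. x + y \<in> S} \<subseteq> (\<lambda>x. 0 + x + (- y)) ` U"
      using SN(1) by (force simp: image_iff add.assoc)
    then have "{x. x + y \<in> S} \<in> null_sets (completion \<nu>)"
      using null null_sets_completion_subset by blast
    moreover have "{x. x + y \<in> S} \<in> sets \<nu>"
      unfolding sets by measurable
    ultimately show "emeasure \<nu> {x. x + y \<in> S} = 0"
      by (simp add: null_sets_completion_iff null_setsD1)
  qed
  finally have "S \<in> null_sets m"
    using SN(4) by (simp add: null_setsI)
  then have V: "S \<union> N' \<in> null_sets m"
    using SN(3) by blast
  then have V_sets[measurable]: "S \<union> N' \<in> sets borel"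
    by (auto simp: m_def)
  have "(\<integral>\<^sup>+ x. emeasure \<rho> {y. x + y \<in> S \<union> N'} \<partial>\<nu>) = emeasure m (S \<union> N')"
    using V_sets vimage[OF V_sets] by (simp add: m_def emeasure_distr[OF add] \<rho>.emeasure_pair_measure_alt
        space space_pair_measure vimage_def del: Un_iff)
  also have "\<dots> = 0"
    by (rule null_setsD1[OF V])
  finally have "AE x in \<nu>. emeasure \<rho> {y. x + y \<in> S \<union> N'} = 0"
    using \<rho>.measurable_emeasure_Pair[OF vimage[OF V_sets]]
    by (subst (asm) nn_integral_0_iff_AE) (simp_all add: space space_pair_measure vimage_def del: Un_iff)
  then obtain x where "emeasure \<rho> {y. x + y \<in> S \<union> N'} = 0"
    using eventually_happens'[OF \<nu>.ae_filter_bot] by blast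
  moreover have "{y. x + y \<in> S \<union> N'} \<in> sets \<rho>"
    unfolding sets by measurable
  ultimately have "{y. x + y \<in> S \<union> N'} \<in> null_sets \<rho>"
    by blast
  then show ?thesis
    using that[OF V_sets, of x] SN by blast
qed

lemma uncountable_compact_in_conull:
  fixes \<rho> :: "'a::polish_space measure"
  assumes \<rho>: "borel_prob \<rho>" and atomless: "\<And>x. {x} \<in> null_sets \<rho>"
    and N: "- W \<in> null_sets \<rho>"
  obtains K where "compact K" "K \<subseteq> W" "uncountable K"
proof -
  interpret prob_space \<rho>
    using \<rho> by (simp add: borel_prob_def)
  have sets: "sets \<rho> = sets borel"
    using \<rho> by (simp add: borel_prob_def)
  have space: "space \<rho> = UNIV"
    using sets_eq_imp_space_eq[OF sets] by simp
  have W: "W \<in> sets borel"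
    using N null_setsD2[OF N] sets by (metis boolean_algebra_class.boolean_algebra.double_compl borel_comp)
  have "emeasure \<rho> W = 1"
    using emeasure_space_1 emeasure_Diff_null_set[OF N, of UNIV] space by (metis Compl_eq_Diff_UNIV double_complement sets.top)
  then have "(SUP K \<in> {K. K \<subseteq> W \<and> compact K}. emeasure \<rho> K) > 0"
    using inner_regular[OF sets _ W] by simp
  then obtain K where K: "K \<subseteq> W" "compact K" "emeasure \<rho> K > 0"
    by (auto simp: less_SUP_iff)
  have "uncountable K"
  proof
    assume "countable K"
    then have "(\<Union>x \<in> K. {x}) \<in> null_sets \<rho>"
      using atomless by (intro null_sets_UN') auto
    then show False
      using K(3) by auto
  qed
  with K that show ?thesis
    by blast
qed

section \<open>A naively Haar null set that is not Haar null\<close>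

theorem theorem1p3:
  assumes "uncountable (UNIV :: 'a::{polish_space, topological_ab_group_add} set)"
  shows "\<exists>X :: 'a set. naively_haar_null X \<and> \<not> haar_null X"
proof -
  obtain c :: "nat \<Rightarrow> 'a" and r F where "lacunary c r F"
    using lacunary_exists[OF zero_islimpt_UNIV[OF assms]] .
  then interpret lacunary c r F .
  define P where "P = subsum ` {w. {k. w k} \<subseteq> {k. odd k}}"
  define Q where "Q = subsum ` {w. {k. w k} \<subseteq> {k. even k}}"
  have "infinite {k :: nat. odd k}" "infinite {k :: nat. even k}"
    by (auto simp: infinite_nat_iff_unbounded_le) presburger+
  then obtain \<mu> \<rho> where \<mu>: "borel_prob \<mu>" "\<And>x. {x} \<in> null_sets \<mu>" "- P \<in> null_sets \<mu>"
    and \<rho>: "borel_prob \<rho>" "\<And>x. {x} \<in> null_sets \<rho>" "- Q \<in> null_sets \<rho>"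
    unfolding P_def Q_def
    using atomless_prob_on_cantor_image[OF continuous_subsum inj_subsum] by metis
  have PQ: "q = q'" if "q \<in> Q" "q' \<in> Q" "p1 \<in> P" "p2 \<in> P" "p3 \<in> P" "p4 \<in> P"
    "q - q' = (p1 - p2) - (p3 - p4)" for q q' p1 p2 p3 p4
  proof -
    have "- {k :: nat. even k} = {k. odd k}"
      by auto
    with that subsum_independent[of _ "{k. even k}"] show ?thesis
      unfolding P_def Q_def by auto metis
  qed
  define I where "I = {B. closed B \<and> (\<exists>g. (UNIV :: real set) \<lesssim> B \<inter> (+) g ` Q)}"
  define R where "R x y \<longleftrightarrow> (\<exists>p \<in> P. \<exists>p' \<in> P. x - y = p - p')" for x y
  have "\<forall>B \<in> I. \<exists>g. (UNIV :: real set) \<lesssim> B \<inter> (+) g ` Q"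
    by (auto simp: I_def)
  then obtain g where g: "\<And>B. B \<in> I \<Longrightarrow> (UNIV :: real set) \<lesssim> B \<inter> (+) (g B) ` Q"
    by metis
  obtain f where f: "\<And>B. B \<in> I \<Longrightarrow> f B \<in> B \<inter> (+) (g B) ` Q"
    and indep: "\<And>B B'. \<lbrakk>B \<in> I; B' \<in> I; B \<noteq> B'\<rbrakk> \<Longrightarrow> \<not> R (f B) (f B')"
  proof (rule transversal_selection[of I "\<lambda>B. B \<inter> (+) (g B) ` Q" R])
    fix B assume "B \<in> I"
    have "I \<lesssim> {B :: 'a set. closed B}"
      by (auto simp: I_def intro: subset_imp_lepoll)
    also have "\<dots> \<lesssim> (UNIV :: real set)"
      by (rule closed_sets_lepoll_real)
    also have "\<dots> \<lesssim> B \<inter> (+) (g B) ` Q"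
      using g \<open>B \<in> I\<close> .
    finally show "I \<lesssim> B \<inter> (+) (g B) ` Q" .
  next
    \<comment> \<open>Two points of \<open>g B + Q\<close> in \<open>y + (P - P)\<close> would differ by an element of \<open>(P - P) - (P - P)\<close>.\<close>
    fix B y x x'
    assume "x \<in> B \<inter> (+) (g B) ` Q" "x' \<in> B \<inter> (+) (g B) ` Q" "R x y" "R x' y"
    then obtain q q' p1 p2 p3 p4 where *: "q \<in> Q" "q' \<in> Q" "x = g B + q" "x' = g B + q'"
      "p1 \<in> P" "p2 \<in> P" "p3 \<in> P" "p4 \<in> P" "x - y = p1 - p2" "x' - y = p3 - p4"
      by (auto simp: R_def)
    have "q - q' = (x - y) - (x' - y)"
      by (simp add: *(3,4))
    then have "q = q'"
      using PQ[OF *(1,2,5-8)] *(9,10) by simp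
    then show "x = x'"
      using * by simp
  next
    show "R y x" if "R x y" for x y
      using that unfolding R_def by (metis minus_diff_eq)
  next
    fix f assume "\<And>B. B \<in> I \<Longrightarrow> f B \<in> B \<inter> (+) (g B) ` Q"
      and "\<And>B B'. \<lbrakk>B \<in> I; B' \<in> I; B \<noteq> B'\<rbrakk> \<Longrightarrow> \<not> R (f B) (f B')"
    then show thesis
      by (rule that)
  qed
  have naive: "naively_haar_null (f ` I)"
    unfolding naively_haar_null_def
  proof (intro exI conjI allI)
    show "borel_prob \<mu>"
      by (rule \<mu>)
    fix a b
    let ?Y = "(\<lambda>x. a + x + b) ` f ` I"
    have unique: "y = y'" if yy: "y \<in> ?Y \<inter> P" "y' \<in> ?Y \<inter> P" for y y'
    proof -
      obtain B B' where B: "B \<in> I" "B' \<in> I" "y = a + f B + b" "y' = a + f B' + b"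
        using yy by auto
      have "f B - f B' = y - y'"
        using B by simp
      then have "R (f B) (f B')"
        using yy unfolding R_def by blast
      then show ?thesis
        using indep B by blast
    qed
    \<comment> \<open>If \<open>?Y \<inter> P\<close> is empty, \<open>z\<close> is an arbitrary point, which is null as well.\<close>
    define z where "z = (SOME y. y \<in> ?Y \<inter> P)"
    have "?Y \<inter> P \<subseteq> {z}"
    proof
      fix y assume y: "y \<in> ?Y \<inter> P"
      then have "z \<in> ?Y \<inter> P"
        unfolding z_def by (rule someI)
      with y show "y \<in> {z}"
        using unique by blast
    qed
    then have "?Y \<subseteq> - P \<union> {z}"
      by blast
    moreover have "- P \<union> {z} \<in> null_sets \<mu>"
      using \<mu> by (intro null_sets.Un)
    ultimately show "?Y \<in> null_sets (completion \<mu>)"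
      using null_sets_completion_iff2 by blast
  qed
  have "\<not> haar_null (f ` I)"
  proof
    assume "haar_null (f ` I)"
    then obtain U \<nu> where U: "universally_measurable U" "f ` I \<subseteq> U" and \<nu>: "borel_prob \<nu>"
      "\<And>g h. (\<lambda>x. g + x + h) ` U \<in> null_sets (completion \<nu>)"
      by (auto simp: haar_null_def)
    obtain x V where V: "V \<in> sets borel" "U \<subseteq> V" "{y. x + y \<in> V} \<in> null_sets \<rho>"
      using translate_avoids_almost_surely[OF U(1) \<nu>(1) \<rho>(1) \<nu>(2)] .
    have "- (Q - {y. x + y \<in> V}) = - Q \<union> {y. x + y \<in> V}"
      by blast
    then have "- (Q - {y. x + y \<in> V}) \<in> null_sets \<rho>"
      using V(3) \<rho>(3) by (simp only: null_sets.Un)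
    then obtain K where K: "compact K" "K \<subseteq> Q - {y. x + y \<in> V}" "uncountable K"
      using uncountable_compact_in_conull[OF \<rho>(1,2)] by blast
    define B where "B = (+) x ` K"
    have "compact B"
      unfolding B_def by (intro compact_continuous_image K continuous_intros)
    then have "closed B"
      by (rule compact_imp_closed)
    have "uncountable B"
      using K(3) by (simp add: B_def countable_image_inj_eq)
    then have "(UNIV :: real set) \<lesssim> B"
      by (intro real_lepoll_uncountable_closed \<open>closed B\<close>)
    moreover have "B \<inter> (+) x ` Q = B"
      using K(2) by (auto simp: B_def)
    ultimately have "B \<in> I"
      using \<open>closed B\<close> by (auto simp: I_def intro!: exI[of _ x])
    then have "f B \<in> B" "f B \<in> U"
      using f U(2) by auto
    then show False
      using K(2) V(2) by (auto simp: B_def)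
  qed
  with naive show ?thesis
    by blast
qed

end
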